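(* Let $(X,\mathcal{B})$ be a resolvable $(v,k,\lambda)$-BIBD with a fixed resolution into parallel classes, let $w=v/k$, and let $(Y,\mathcal{C})$ be a $3$-$(w,k',\lambda')$-design on $Y=\{1,\dots,w\}$. Let $(X,\mathcal{D})$ be the constructed design obtained from these two designs. Then $(X,\mathcal{D})$ is a $3$-design if and only if at least one of the following holds: (1) $(X,\mathcal{B})$ is a $3$-design; (2) $k=2$; (3) $k'=v/(2k)$.
   Context: For positive integers $v,b,r,k$ with $2\le k<v$, a $(v,b,r,k)$-incomplete block design (IBD) is a pair $(X,\mathcal{B})$ where $X$ is a set of $v$ points and $\mathcal{B}$ is a multiset of $b$ subsets of $X$ (blocks), each of size $k$, such that every point lies in exactly $r$ blocks. If $k\mid v$, a parallel class is a set of $v/k$ pairwise disjoint blocks; the IBD is resolvable if $\mathcal{B}$ can be partitioned into $r$ parallel classes (a resolution). A $(v,k,\lambda)$-BIBD is an IBD with block size $k$ in which every pair of distinct points lies in exactly $\lambda$ blocks. For $t\le k<v$, a $t$-$(v,k,\lambda)$-design is a pair $(X,\mathcal{B})$ with $|X|=v$ and $\mathcal{B}$ a multiset of $k$-subsets of $X$ such that every $t$-subset of $X$ lies in exactly $\lambda$ blocks; a $3$-design is a $3$-$(v,k,\mu)$-design for some $\mu$. Constructed design: given a resolvable IBD $(X,\mathcal{B})$ with block size $k$ and a resolution into parallel classes $\Pi_1,\dots,\Pi_r$, where $\Pi_i=\{B_i^1,\dots,B_i^w\}$ and $w=v/k$, and given an IBD $(Y,\mathcal{C})$ with $Y=\{1,\dots,w\}$,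 define for each $i$ and each block $C\in\mathcal{C}$ the set $D_{i,C}=\bigcup_{j\in C}B_i^j$, and let $\mathcal{D}$ be the multiset $\{D_{i,C}: 1\le i\le r,\ C\in\mathcal{C}\}$. The constructed design is $(X,\mathcal{D})$. *)

theory Defs
  imports Complex_Main "HOL-Library.Multiset"
begin

definition is_ibd :: "nat \<Rightarrow> nat \<Rightarrow> nat \<Rightarrow> nat \<Rightarrow> 'a set \<Rightarrow> 'a set multiset \<Rightarrow> bool" where
  "is_ibd v b r k X \<B> \<longleftrightarrow>
     0 < v \<and> 0 < b \<and> 0 < r \<and> 2 \<le> k \<and> k < v \<and>
     finite X \<and> card X = v \<and> size \<B> = b \<and>
     (\<forall>A\<in>#\<B>. A \<subseteq> X \<and> card A = k) \<and>
     (\<forall>x\<in>X. size {#A \<in># \<B>. x \<in> A#} = r)"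

definition is_bibd :: "nat \<Rightarrow> nat \<Rightarrow> nat \<Rightarrow> 'a set \<Rightarrow> 'a set multiset \<Rightarrow> bool" where
  "is_bibd v k \<Lambda> X \<B> \<longleftrightarrow>
     (\<exists>b r. is_ibd v b r k X \<B>) \<and>
     (\<forall>x\<in>X. \<forall>y\<in>X. x \<noteq> y \<longrightarrow> size {#A \<in># \<B>. x \<in> A \<and> y \<in> A#} = \<Lambda>)"

definition is_t_design :: "nat \<Rightarrow> nat \<Rightarrow> nat \<Rightarrow> nat \<Rightarrow> 'a set \<Rightarrow> 'a set multiset \<Rightarrow> bool" where
  "is_t_design t v k \<Lambda> X \<B> \<longleftrightarrow>
     t \<le> k \<and> k < v \<and> finite X \<and> card X = v \<and>
     (\<forall>A\<in>#\<B>. A \<subseteq> X \<and> card A = k) \<and>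
     (\<forall>T. T \<subseteq> X \<and> card T = t \<longrightarrow> size {#A \<in># \<B>. T \<subseteq> A#} = \<Lambda>)"

definition is_3_design :: "'a set \<Rightarrow> 'a set multiset \<Rightarrow> bool" where
  "is_3_design X \<B> \<longleftrightarrow> (\<exists>v k \<mu>. is_t_design 3 v k \<mu> X \<B>)"

definition is_parallel_class :: "nat \<Rightarrow> nat \<Rightarrow> 'a set multiset \<Rightarrow> 'a set set \<Rightarrow> bool" where
  "is_parallel_class v k \<B> P \<longleftrightarrow>
     k dvd v \<and> P \<subseteq> set_mset \<B> \<and> card P = v div k \<and> pairwise disjnt P"

text \<open>The classes of a resolution are indexed by \<open>1, \<dots>, r\<close>; the multiset equation says that
  they partition the block multiset, so a block of multiplicity \<open>m\<close> lies in exactly \<open>m\<close> classes.\<close>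

definition is_resolution ::
  "nat \<Rightarrow> nat \<Rightarrow> nat \<Rightarrow> nat \<Rightarrow> 'a set \<Rightarrow> 'a set multiset \<Rightarrow> (nat \<Rightarrow> 'a set set) \<Rightarrow> bool" where
  "is_resolution v b r k X \<B> \<Pi> \<longleftrightarrow>
     is_ibd v b r k X \<B> \<and>
     (\<forall>i\<in>{1..r}. is_parallel_class v k \<B> (\<Pi> i)) \<and>
     \<B> = (\<Sum>i = 1..r. mset_set (\<Pi> i))"

text \<open>\<open>Bl i j\<close> is the \<open>j\<close>-th block of the \<open>i\<close>-th parallel class.\<close>

definition constructed_blocks ::
  "nat \<Rightarrow> (nat \<Rightarrow> nat \<Rightarrow> 'a set) \<Rightarrow> nat set multiset \<Rightarrow> 'a set multiset" where
  "constructed_blocks r Bl \<C> = (\<Sum>i = 1..r. {# \<Union>j\<in>C. Bl i j. C \<in># \<C> #})"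

end

theory Submission
  imports Defs
begin

text \<open>For a triple \<open>T\<close> of points let \<open>a(T)\<close> be the number of blocks of \<open>\<B>\<close> containing \<open>T\<close>, and let
  \<open>\<lambda>\<^sub>2\<close> be the pair index of \<open>\<C>\<close>. In \<open>a(T)\<close> classes the triple lies in one block, in
  \<open>3(\<Lambda> - a(T))\<close> classes it meets exactly two blocks, and in the others it meets three. Hence \<open>T\<close> lies
  in \<open>K + a(T) (r' - 3 \<lambda>\<^sub>2 + 2 \<Lambda>')\<close> blocks of the constructed design, with \<open>K\<close> independent
  of \<open>T\<close>. The standard index relations give
  \<open>(k' - 1) (k' - 2) (r' - 3 \<lambda>\<^sub>2 + 2 \<Lambda>') = \<Lambda>' (w - k') (w - 2 k')\<close>, so the constructed design is a
  3-design if and only if \<open>a\<close> is constant or \<open>w = 2 k'\<close>; and \<open>a\<close> is constantly \<open>0\<close> when \<open>k = 2\<close>.\<close>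

section \<open>Block counts, parallel classes and index relations\<close>

definition block_count :: "'a set multiset \<Rightarrow> 'a set \<Rightarrow> nat" where
  "block_count \<B> S = size {#A \<in># \<B>. S \<subseteq> A#}"

lemma block_count_empty [simp]: "block_count {#} S = 0"
  by (simp add: block_count_def)

lemma block_count_add_mset [simp]:
  "block_count (add_mset A \<B>) S = of_bool (S \<subseteq> A) + block_count \<B> S"
  by (simp add: block_count_def)

lemma block_count_sum: "block_count (\<Sum>i\<in>I. F i) S = (\<Sum>i\<in>I. block_count (F i) S)"
  by (induction I rule: infinite_finite_induct) (simp_all add: block_count_def)

lemma block_count_image_mset:
  assumes "\<And>C. C \<in># \<C> \<Longrightarrow> S \<subseteq> f C \<longleftrightarrow> S' \<subseteq> C"
  shows "block_count (image_mset f \<C>) S = block_count \<C> S'"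
  using assms by (induction \<C>) auto

text \<open>Double counting of the pairs of a block \<open>A\<close> containing \<open>S\<close> and
  a point \<open>y\<close> of \<open>A - S\<close>: each such block admits \<open>k - card S\<close>
  points. If \<open>card S\<close> exceeds \<open>k\<close>, no block contains \<open>S\<close>, so
  truncated subtraction does no harm.\<close>

lemma sum_block_count_insert:
  assumes "finite X" and "\<And>A. A \<in># \<B> \<Longrightarrow> A \<subseteq> X \<and> card A = k"
  shows "(\<Sum>y\<in>X - S. block_count \<B> (insert y S)) = (k - card S) * block_count \<B> S"
  using assms(2)
proof (induction \<B>)
  case empty
  then show ?case by simp
next
  case (add A \<B>)
  have A: "A \<subseteq> X" "card A = k" using add.prems by auto
  have "(\<Sum>y\<in>X - S. of_bool (insert y S \<subseteq> A)) = (k - card S) * of_bool (S \<subseteq> A)"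
  proof (cases "S \<subseteq> A")
    case True
    have "finite A" using A assms(1) finite_subset by blast
    have "(\<Sum>y\<in>X - S. of_bool (insert y S \<subseteq> A)) = card ((X - S) \<inter> {y. insert y S \<subseteq> A})"
      using assms(1) by (simp add: sum_of_bool_eq)
    also have "(X - S) \<inter> {y. insert y S \<subseteq> A} = A - S" using True A by auto
    also have "card (A - S) = k - card S"
      using True A \<open>finite A\<close> by (simp add: card_Diff_subset finite_subset)
    finally show ?thesis using True by simp
  next
    case False
    then show ?thesis by simp
  qed
  then show ?case
    using add by (simp add: sum.distrib add_mult_distrib2 del: insert_subset)
qed

text \<open>A nonempty set fits into a singleton only if it is that singleton. This serves to read
  the original blocks as a constructed design.\<close>

lemma block_count_singletons:
  assumes "finite Y" and "S \<subseteq> Y" and "S \<noteq> {}"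
  shows "block_count {#{j}. j \<in># mset_set Y#} S = of_bool (card S = 1)"
proof -
  have "block_count {#{j}. j \<in># mset_set Y#} S = card {j \<in> Y. S \<subseteq> {j}}"
    using assms(1) by (simp add: block_count_def filter_mset_image_mset)
  also have "{j \<in> Y. S \<subseteq> {j}} = {j. S = {j}}"
    using assms by auto
  also have "card {j. S = {j}} = of_bool (card S = 1)"
  proof (cases "card S = 1")
    case True
    then obtain j where "S = {j}" by (auto simp: card_1_singleton_iff)
    then have "{j. S = {j}} = {j}" by auto
    then show ?thesis using True by simp
  next
    case False
    then have "{j. S = {j}} = {}" by auto
    then show ?thesis using False by simp
  qed
  finally show ?thesis .
qed

text \<open>\<open>c i x\<close> is the label of the block of class \<open>i\<close> through
  \<open>x\<close>. A union of blocks with labels in \<open>C\<close> contains \<open>x\<close>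
  exactly when \<open>c i x\<close> lies in \<open>C\<close>, so containment of \<open>S\<close>
  becomes containment of its set of labels.\<close>

lemma block_count_constructed_blocks:
  assumes "\<And>i x j. i \<in> {1..r} \<Longrightarrow> x \<in> X \<Longrightarrow> j \<in> Y \<Longrightarrow> x \<in> Bl i j \<longleftrightarrow> j = c i x"
    and "\<And>i x. i \<in> {1..r} \<Longrightarrow> x \<in> X \<Longrightarrow> c i x \<in> Y"
    and "\<And>C. C \<in># \<C> \<Longrightarrow> C \<subseteq> Y"
    and "S \<subseteq> X"
  shows "block_count (constructed_blocks r Bl \<C>) S = (\<Sum>i = 1..r. block_count \<C> (c i ` S))"
  unfolding constructed_blocks_def block_count_sum
proof (rule sum.cong[OF refl], rule block_count_image_mset)
  fix i C
  assume i: "i \<in> {1..r}" and C: "C \<in># \<C>"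
  have "x \<in> (\<Union>j\<in>C. Bl i j) \<longleftrightarrow> c i x \<in> C" if "x \<in> S" for x
    using assms(1)[OF i] assms(2)[OF i] assms(3)[OF C] assms(4) that
    by (metis UN_iff subset_eq)
  then show "S \<subseteq> (\<Union>j\<in>C. Bl i j) \<longleftrightarrow> c i ` S \<subseteq> C" by blast
qed

text \<open>\<open>v div k\<close> disjoint blocks of size \<open>k\<close> cover \<open>v\<close>
  points, which is all of \<open>X\<close>.\<close>

lemma parallel_class_Union:
  assumes "finite X" and "card X = v" and "0 < k"
    and "\<And>A. A \<in># \<B> \<Longrightarrow> A \<subseteq> X \<and> card A = k"
    and "is_parallel_class v k \<B> P"
  shows "\<Union>P = X"
proof (rule card_subset_eq)
  have P: "P \<subseteq> set_mset \<B>" "card P = v div k" "pairwise disjnt P" "k dvd v"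
    using assms(5) by (auto simp: is_parallel_class_def)
  show "\<Union>P \<subseteq> X" using P assms(4) by blast
  have "card (\<Union>P) = sum card P"
    using P assms by (intro card_Union_disjoint) (auto dest: finite_subset)
  also have "\<dots> = (\<Sum>A\<in>P. k)" using P assms(4) by (intro sum.cong) auto
  also have "\<dots> = card X" using P assms(2) by simp
  finally show "card (\<Union>P) = card X" .
qed (fact assms(1))

text \<open>Double counting descends from triples to pairs and from pairs to points. The indices are
  real so that they can be defined as quotients; \<open>3 \<le> k\<close> keeps the divisors
  nonzero.\<close>

lemma index_relations_3_design:
  assumes "finite Y" and "card Y = w" and "3 \<le> k" and "k < w"
    and blocks: "\<And>A. A \<in># \<C> \<Longrightarrow> A \<subseteq> Y \<and> card A = k"
    and triples: "\<And>T. T \<subseteq> Y \<Longrightarrow> card T = 3 \<Longrightarrow> block_count \<C> T = \<Lambda>"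
  shows "\<exists>\<mu>\<^sub>1 \<mu>\<^sub>2 :: real.
    (\<forall>x\<in>Y. real (block_count \<C> {x}) = \<mu>\<^sub>1) \<and>
    (\<forall>x\<in>Y. \<forall>y\<in>Y. x \<noteq> y \<longrightarrow> real (block_count \<C> {x, y}) = \<mu>\<^sub>2) \<and>
    \<mu>\<^sub>1 * (real k - 1) = \<mu>\<^sub>2 * (real w - 1) \<and>
    \<mu>\<^sub>2 * (real k - 2) = real \<Lambda> * (real w - 2)"
proof -
  define \<mu>\<^sub>2 where "\<mu>\<^sub>2 = real \<Lambda> * (real w - 2) / (real k - 2)"
  define \<mu>\<^sub>1 where "\<mu>\<^sub>1 = \<mu>\<^sub>2 * (real w - 1) / (real k - 1)"
  have pair: "real (block_count \<C> {x, y}) = \<mu>\<^sub>2" if "x \<in> Y" "y \<in> Y" "x \<noteq> y" for x y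
  proof -
    have "(\<Sum>z\<in>Y - {x, y}. block_count \<C> (insert z {x, y})) = (\<Sum>z\<in>Y - {x, y}. \<Lambda>)"
      using that by (intro sum.cong triples) auto
    also have "\<dots> = (w - 2) * \<Lambda>"
      using that assms(1,2) by (simp add: card_Diff_subset numeral_2_eq_2)
    finally have "(w - 2) * \<Lambda> = (k - 2) * block_count \<C> {x, y}"
      using sum_block_count_insert[OF assms(1) blocks, of \<C> "{x, y}"] that by (simp add: numeral_2_eq_2)
    then have "real (w - 2) * real \<Lambda> = real (k - 2) * real (block_count \<C> {x, y})"
      by (metis of_nat_mult)
    then show ?thesis
      using assms(3,4) by (simp add: \<mu>\<^sub>2_def of_nat_diff field_simps)
  qed
  have point: "real (block_count \<C> {x}) = \<mu>\<^sub>1" if "x \<in> Y" for x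
  proof -
    have "real (\<Sum>z\<in>Y - {x}. block_count \<C> (insert z {x})) = (\<Sum>z\<in>Y - {x}. \<mu>\<^sub>2)"
      unfolding of_nat_sum using that by (intro sum.cong pair) auto
    also have "\<dots> = (w - 1) * \<mu>\<^sub>2"
      using that assms(1,2) by (simp add: card_Diff_subset)
    finally have "real (w - 1) * \<mu>\<^sub>2 = real (k - 1) * real (block_count \<C> {x})"
      using sum_block_count_insert[OF assms(1) blocks, of \<C> "{x}"] by simp
    then show ?thesis
      using assms(3,4) by (simp add: \<mu>\<^sub>1_def of_nat_diff field_simps)
  qed
  have "\<mu>\<^sub>1 * (real k - 1) = \<mu>\<^sub>2 * (real w - 1)" "\<mu>\<^sub>2 * (real k - 2) = real \<Lambda> * (real w - 2)"
    using assms(3) by (simp_all add: \<mu>\<^sub>1_def \<mu>\<^sub>2_def)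
  then show ?thesis using point pair by blast
qed

text \<open>Once the block size is known and admissible, constancy of the triple count is all that
  remains of \<open>is_3_design\<close>.\<close>

lemma is_3_design_iff_block_count_constant:
  assumes "finite X" and "3 \<le> k" and "k < card X"
    and "\<And>A. A \<in># \<B> \<Longrightarrow> A \<subseteq> X \<and> card A = k"
  shows "is_3_design X \<B> \<longleftrightarrow> (\<exists>\<mu>. \<forall>T. T \<subseteq> X \<and> card T = 3 \<longrightarrow> block_count \<B> T = \<mu>)"
proof
  assume "is_3_design X \<B>"
  then show "\<exists>\<mu>. \<forall>T. T \<subseteq> X \<and> card T = 3 \<longrightarrow> block_count \<B> T = \<mu>"
    by (auto simp: is_3_design_def is_t_design_def block_count_def)
next
  assume "\<exists>\<mu>. \<forall>T. T \<subseteq> X \<and> card T = 3 \<longrightarrow> block_count \<B> T = \<mu>"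
  then obtain \<mu> where "is_t_design 3 (card X) k \<mu> X \<B>"
    using assms by (auto simp: is_t_design_def block_count_def)
  then show "is_3_design X \<B>" by (auto simp: is_3_design_def)
qed

theorem theorem2p5:
  fixes X :: "'a set" and \<B> :: "'a set multiset" and \<C> :: "nat set multiset"
    and \<Pi> :: "nat \<Rightarrow> 'a set set" and Bl :: "nat \<Rightarrow> nat \<Rightarrow> 'a set"
    and v b r k \<Lambda> w b' r' k' \<Lambda>' :: nat
  assumes bibd: "is_bibd v k \<Lambda> X \<B>"
    and resolution: "is_resolution v b r k X \<B> \<Pi>"
    and w: "w = v div k"
    and labelling: "\<And>i. i \<in> {1..r} \<Longrightarrow> bij_betw (Bl i) {1..w} (\<Pi> i)"
    and ibd: "is_ibd w b' r' k' {1..w} \<C>"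
    and design: "is_t_design 3 w k' \<Lambda>' {1..w} \<C>"
  shows "is_3_design X (constructed_blocks r Bl \<C>) \<longleftrightarrow>
           is_3_design X \<B> \<or> k = 2 \<or> real k' = real v / (2 * real k)"
proof -
  let ?D = "constructed_blocks r Bl \<C>"
  have X: "finite X" "card X = v" and k: "2 \<le> k" "k < v" and r: "0 < r"
    and blocks: "\<And>A. A \<in># \<B> \<Longrightarrow> A \<subseteq> X \<and> card A = k"
    and classes: "\<And>i. i \<in> {1..r} \<Longrightarrow> is_parallel_class v k \<B> (\<Pi> i)"
    and \<B>: "\<B> = (\<Sum>i = 1..r. mset_set (\<Pi> i))"
    using resolution by (auto simp: is_resolution_def is_ibd_def)
  have pairs: "block_count \<B> {x, y} = \<Lambda>" if "x \<in> X" "y \<in> X" "x \<noteq> y" for x y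
    using bibd that by (simp add: is_bibd_def block_count_def)
  have k': "3 \<le> k'" "k' < w"
    and cblocks: "\<And>C. C \<in># \<C> \<Longrightarrow> C \<subseteq> {1..w} \<and> card C = k'"
    and ctriples: "\<And>T. T \<subseteq> {1..w} \<Longrightarrow> card T = 3 \<Longrightarrow> block_count \<C> T = \<Lambda>'"
    using design by (auto simp: is_t_design_def block_count_def)
  have "k dvd v" using classes[of 1] r by (simp add: is_parallel_class_def)
  then have v: "v = k * w" using w by simp

  \<comment> \<open>Labels of points within each parallel class\<close>
  define c where "c i x = (THE j. j \<in> {1..w} \<and> x \<in> Bl i j)" for i x
  \<comment> \<open>Existence holds because a parallel class covers \<open>X\<close>, uniqueness
    because its blocks are disjoint and \<open>Bl i\<close> is injective.\<close>
  have ex1: "\<exists>!j. j \<in> {1..w} \<and> x \<in> Bl i j" if i: "i \<in> {1..r}" and "x \<in> X" for i x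
  proof -
    have bij: "bij_betw (Bl i) {1..w} (\<Pi> i)" by (rule labelling[OF i])
    have "\<Union>(\<Pi> i) = X"
      using X k blocks classes[OF i] by (intro parallel_class_Union) auto
    then obtain A where A: "A \<in> \<Pi> i" "x \<in> A" using \<open>x \<in> X\<close> by blast
    have "A \<in> Bl i ` {1..w}"
      using A(1) bij_betw_imp_surj_on[OF bij] by simp
    then obtain j where j: "j \<in> {1..w}" "Bl i j = A" by (elim imageE) simp
    have "j' = j" if "j' \<in> {1..w}" "x \<in> Bl i j'" for j'
    proof (rule ccontr)
      assume "j' \<noteq> j"
      then have "Bl i j' \<noteq> Bl i j"
        using bij j(1) that(1) by (metis bij_betw_imp_inj_on inj_on_eq_iff)
      moreover have "Bl i j' \<in> \<Pi> i" using bij that(1) by (rule bij_betw_apply)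
      moreover have "pairwise disjnt (\<Pi> i)"
        using classes[OF i] by (simp add: is_parallel_class_def)
      ultimately have "disjnt (Bl i j') A"
        using A(1) j(2) pairwiseD by metis
      then show False using A(2) that(2) by (auto simp: disjnt_def)
    qed
    then show ?thesis using A j by blast
  qed
  have c_range: "c i x \<in> {1..w}" if "i \<in> {1..r}" "x \<in> X" for i x
    using theI'[OF ex1[OF that]] by (simp add: c_def)
  have c_iff: "x \<in> Bl i j \<longleftrightarrow> j = c i x" if "i \<in> {1..r}" "x \<in> X" "j \<in> {1..w}" for i x j
    using theI'[OF ex1[OF that(1,2)]] ex1[OF that(1,2)] that(3) unfolding c_def by blast

  have count_D: "block_count ?D S = (\<Sum>i = 1..r. block_count \<C> (c i ` S))" if "S \<subseteq> X" for S
    by (rule block_count_constructed_blocks[where Y = "{1..w}" and X = X])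
       (use c_iff c_range cblocks that in auto)
  \<comment> \<open>\<open>\<B>\<close> is itself the design constructed from the one-point blocks on \<open>{1..w}\<close>.\<close>
  have "\<B> = constructed_blocks r Bl {#{j}. j \<in># mset_set {1..w}#}"
  proof -
    have "mset_set (\<Pi> i) = image_mset (Bl i) (mset_set {1..w})" if "i \<in> {1..r}" for i
      using labelling[OF that] by (metis bij_betw_def image_mset_mset_set)
    then show ?thesis
      unfolding constructed_blocks_def by (subst \<B>) (simp add: multiset.map_comp o_def)
  qed
  then have "block_count \<B> S = (\<Sum>i = 1..r. block_count {#{j}. j \<in># mset_set {1..w}#} (c i ` S))"
    if "S \<subseteq> X" for S
    using block_count_constructed_blocks[where Y = "{1..w}" and X = X and c = c and r = r
        and Bl = Bl and S = S and \<C> = "{#{j}. j \<in># mset_set {1..w}#}"] c_iff c_range that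
    by auto
  \<comment> \<open>A class contributes 1 exactly when all points of \<open>S\<close> have the same
    label, that is, lie in one block of the class.\<close>
  then have count_B: "block_count \<B> S = (\<Sum>i = 1..r. of_bool (card (c i ` S) = 1))"
    if "S \<subseteq> X" "S \<noteq> {}" for S
    using that c_range by (simp add: block_count_singletons subset_eq)

  \<comment> \<open>The triple count of the constructed design\<close>
  have "\<exists>\<mu>\<^sub>1 \<mu>\<^sub>2 :: real.
      (\<forall>j\<in>{1..w}. real (block_count \<C> {j}) = \<mu>\<^sub>1) \<and>
      (\<forall>j\<in>{1..w}. \<forall>l\<in>{1..w}. j \<noteq> l \<longrightarrow> real (block_count \<C> {j, l}) = \<mu>\<^sub>2) \<and>
      \<mu>\<^sub>1 * (real k' - 1) = \<mu>\<^sub>2 * (real w - 1) \<and>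
      \<mu>\<^sub>2 * (real k' - 2) = real \<Lambda>' * (real w - 2)"
    by (rule index_relations_3_design) (simp, simp, fact k', fact k', fact cblocks, fact ctriples)
  then obtain \<mu>\<^sub>1 \<mu>\<^sub>2 where
    \<mu>: "\<forall>j\<in>{1..w}. real (block_count \<C> {j}) = \<mu>\<^sub>1"
      "\<forall>j\<in>{1..w}. \<forall>l\<in>{1..w}. j \<noteq> l \<longrightarrow> real (block_count \<C> {j, l}) = \<mu>\<^sub>2" and
    rel1: "\<mu>\<^sub>1 * (real k' - 1) = \<mu>\<^sub>2 * (real w - 1)" and
    rel2: "\<mu>\<^sub>2 * (real k' - 2) = real \<Lambda>' * (real w - 2)"
    by (elim exE conjE)
  note \<mu>\<^sub>1 = \<mu>(1)[rule_format] and \<mu>\<^sub>2 = \<mu>(2)[rule_format]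

  \<comment> \<open>\<kappa> is the correction for triples with a single label: there the remaining
    terms give \<open>\<Lambda>' + 3 * (\<mu>\<^sub>2 - \<Lambda>')\<close>, while the count is
    \<open>\<mu>\<^sub>1\<close>. \<open>K\<close> collects the terms left once every pair count is
    replaced by \<Lambda>.\<close>
  define \<kappa> where "\<kappa> = \<mu>\<^sub>1 - 3 * \<mu>\<^sub>2 + 2 * real \<Lambda>'"
  define K where "K = 3 * real \<Lambda> * \<mu>\<^sub>2 + (real r - 3 * real \<Lambda>) * real \<Lambda>'"
  have count: "real (block_count ?D T) = K + \<kappa> * real (block_count \<B> T)"
    if T: "T \<subseteq> X" "card T = 3" for T
  proof -
    obtain x y z where xyz: "T = {x, y, z}" "x \<noteq> y" "x \<noteq> z" "y \<noteq> z"
      using T(2) by (auto simp: card_3_iff)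
    let ?e = "\<lambda>S i. of_bool (card (c i ` S) = 1) :: real"
    have e: "(\<Sum>i = 1..r. ?e S i) = real (block_count \<B> S)" if "S \<subseteq> X \<and> S \<noteq> {}" for S
      using count_B[of S] that by simp
    have sub: "{x, y} \<subseteq> X \<and> {x, y} \<noteq> {}" "{x, z} \<subseteq> X \<and> {x, z} \<noteq> {}"
      "{y, z} \<subseteq> X \<and> {y, z} \<noteq> {}" "T \<subseteq> X \<and> T \<noteq> {}"
      using T xyz by auto
    \<comment> \<open>One formula for three cases: three distinct labels give \<Lambda>', exactly
      two equal labels give \<open>\<mu>\<^sub>2\<close>, and a single label makes all four
      indicators 1 and gives \<open>\<mu>\<^sub>1\<close>.\<close>
    have "real (block_count \<C> (c i ` T)) =
        \<Lambda>' + (\<mu>\<^sub>2 - \<Lambda>') * ?e {x, y} i + (\<mu>\<^sub>2 - \<Lambda>') * ?e {x, z} i + (\<mu>\<^sub>2 - \<Lambda>') * ?e {y, z} i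
        + \<kappa> * ?e T i" if i: "i \<in> {1..r}" for i
    proof -
      have range: "c i x \<in> {1..w}" "c i y \<in> {1..w}" "c i z \<in> {1..w}"
        using c_range[OF i] T xyz by auto
      \<comment> \<open>Removes the nonadjacent repetition that appears when \<open>x\<close> and
        \<open>z\<close> share a label.\<close>
      have zyz: "{c i z, c i y, c i z} = {c i z, c i y}" by auto
      show ?thesis
        using range \<mu>\<^sub>1[OF range(1)] \<mu>\<^sub>2[OF range(1) range(2)] \<mu>\<^sub>2[OF range(1) range(3)]
          ctriples[of "{c i x, c i y, c i z}"]
        by (cases "c i x = c i y"; cases "c i x = c i z"; cases "c i y = c i z")
           (simp_all add: xyz(1) zyz \<kappa>_def card_insert_if)
    qed
    then have "real (block_count ?D T) = (\<Sum>i = 1..r.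
        \<Lambda>' + (\<mu>\<^sub>2 - \<Lambda>') * ?e {x, y} i + (\<mu>\<^sub>2 - \<Lambda>') * ?e {x, z} i + (\<mu>\<^sub>2 - \<Lambda>') * ?e {y, z} i
        + \<kappa> * ?e T i)"
      unfolding count_D[OF T(1)] of_nat_sum by (rule sum.cong[OF refl])
    also have "\<dots> = r * \<Lambda>' + (\<mu>\<^sub>2 - \<Lambda>') * block_count \<B> {x, y} + (\<mu>\<^sub>2 - \<Lambda>') * block_count \<B> {x, z}
        + (\<mu>\<^sub>2 - \<Lambda>') * block_count \<B> {y, z} + \<kappa> * block_count \<B> T"
      unfolding sum.distrib sum_distrib_left[symmetric] e[OF sub(1)] e[OF sub(2)] e[OF sub(3)]
        e[OF sub(4)] by simp
    also have "\<dots> = K + \<kappa> * block_count \<B> T"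
      using T xyz pairs[of x y] pairs[of x z] pairs[of y z] by (simp add: K_def algebra_simps)
    finally show ?thesis .
  qed

  \<comment> \<open>Vanishing of the coefficient \<kappa>\<close>
  have "1 \<in> {1..w}" using k' by simp
  then have "\<mu>\<^sub>1 = real r'"
    using \<mu>\<^sub>1[of 1] ibd by (simp add: is_ibd_def block_count_def)
  then have "\<mu>\<^sub>1 > 0" using ibd by (simp add: is_ibd_def)
  \<comment> \<open>With \<Lambda>' zero, the index relations would force
    \<open>\<mu>\<^sub>2\<close> and then the replication number \<open>\<mu>\<^sub>1\<close> to
    vanish.\<close>
  have "\<Lambda>' \<noteq> 0"
  proof
    assume "\<Lambda>' = 0"
    then have "\<mu>\<^sub>2 = 0" using rel2 k' by simp
    then show False using rel1 k' \<open>\<mu>\<^sub>1 > 0\<close> by simp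
  qed
  have "(real k' - 1) * (real k' - 2) * \<kappa> = real \<Lambda>' * (real w - real k') * (real w - 2 * real k')"
    using rel1 rel2 unfolding \<kappa>_def by algebra
  \<comment> \<open>Since \<open>3 \<le> k'\<close> and \<open>k' < w\<close>, the factor
    \<open>w - 2 * k'\<close> is the only one besides \<kappa> that can be zero.\<close>
  then have "\<kappa> = 0 \<longleftrightarrow> real w = 2 * real k'"
    using \<open>\<Lambda>' \<noteq> 0\<close> k' by auto
  also have "\<dots> \<longleftrightarrow> real k' = real v / (2 * real k)"
    using k by (auto simp: v field_simps)
  finally have \<kappa>_iff: "\<kappa> = 0 \<longleftrightarrow> real k' = real v / (2 * real k)" .

  \<comment> \<open>From triple counts to 3-designs\<close>
  let ?const = "\<lambda>\<A>. \<exists>\<mu>. \<forall>T. T \<subseteq> X \<and> card T = 3 \<longrightarrow> block_count \<A> T = \<mu>"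
  have D_blocks: "D \<subseteq> X \<and> card D = k * k'" if D_in: "D \<in># ?D" for D
  proof -
    obtain i C where i: "i \<in> {1..r}" and C: "C \<in># \<C>" and D: "D = (\<Union>j\<in>C. Bl i j)"
      using D_in by (auto simp: constructed_blocks_def set_mset_sum)
    have Bl: "Bl i j \<subseteq> X \<and> card (Bl i j) = k" if "j \<in> C" for j
    proof -
      have "Bl i j \<in> \<Pi> i"
        using labelling[OF i] cblocks[OF C] that bij_betw_apply by fast
      then show ?thesis using blocks classes[OF i] by (auto simp: is_parallel_class_def)
    qed
    have "card D = (\<Sum>j\<in>C. card (Bl i j))"
      unfolding D
    proof (rule card_UN_disjoint)
      show "finite C" using cblocks[OF C] finite_subset by blast
      show "\<forall>j\<in>C. finite (Bl i j)" using Bl X finite_subset by blast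
      show "\<forall>j\<in>C. \<forall>l\<in>C. j \<noteq> l \<longrightarrow> Bl i j \<inter> Bl i l = {}"
      proof (intro ballI impI)
        fix j l
        assume j: "j \<in> C" and l: "l \<in> C" and "j \<noteq> l"
        have "j \<in> {1..w}" "l \<in> {1..w}" using j l cblocks[OF C] by blast+
        \<comment> \<open>A common point would have both \<open>j\<close> and \<open>l\<close> as
          its label.\<close>
        then have "x \<notin> Bl i l" if "x \<in> Bl i j" for x
          using that Bl[OF j] c_iff[OF i] \<open>j \<noteq> l\<close> by (metis subsetD)
        then show "Bl i j \<inter> Bl i l = {}" by blast
      qed
    qed
    also have "\<dots> = k * k'" using Bl cblocks[OF C] by simp
    finally show ?thesis using Bl D by auto
  qed
  have "3 \<le> k * k'" using k k' mult_le_mono[of 1 k 3 k'] by simp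
  then have D_iff: "is_3_design X ?D \<longleftrightarrow> ?const ?D"
    using D_blocks X k k' v by (intro is_3_design_iff_block_count_constant) auto
  \<comment> \<open>For \<open>k = 2\<close> the triple count is constantly 0, yet
    \<open>is_3_design\<close> fails because it demands block size at least 3; hence the separate
    alternative.\<close>
  have B_iff: "?const \<B> \<longleftrightarrow> is_3_design X \<B> \<or> k = 2"
  proof (cases "k = 2")
    case True
    have "block_count \<B> T = 0" if "card T = 3" for T
    proof -
      have "\<not> T \<subseteq> A" if "A \<in># \<B>" for A
        using blocks[OF that] True X \<open>card T = 3\<close> card_mono[of A T] finite_subset by fastforce
      then show ?thesis by (auto simp: block_count_def)
    qed
    then show ?thesis using True by blast
  next
    case False
    then have "is_3_design X \<B> \<longleftrightarrow> ?const \<B>"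
      using blocks X k by (intro is_3_design_iff_block_count_constant) auto
    then show ?thesis using False by blast
  qed
  have "?const ?D \<longleftrightarrow> ?const \<B> \<or> \<kappa> = 0"
  proof (cases "\<kappa> = 0")
    case True
    \<comment> \<open>\<open>K\<close> is real, but it equals the count of any triple, so rounding
      down is exact.\<close>
    then have "block_count ?D T = nat \<lfloor>K\<rfloor>" if "T \<subseteq> X" "card T = 3" for T
      using count[OF that] by (metis add.right_neutral floor_of_nat mult_zero_left nat_int)
    then show ?thesis using True by blast
  next
    case False
    \<comment> \<open>An affine function with nonzero slope \<kappa> is injective, so both counts
      identify the same triples.\<close>
    have "block_count ?D T = block_count ?D T' \<longleftrightarrow> block_count \<B> T = block_count \<B> T'"
      if "T \<subseteq> X" "card T = 3" "T' \<subseteq> X" "card T' = 3" for T T'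
      using count[OF that(1,2)] count[OF that(3,4)] False
      by (metis add_left_cancel mult_cancel_left of_nat_eq_iff)
    then show ?thesis using False by metis
  qed
  then show ?thesis using D_iff B_iff \<kappa>_iff by blast
qed

end
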